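(* Let $\delta\ge 0$, let $\mathcal{O}$ be an accounting oracle, and consider the algorithm "DPVI for mixture models on vertically partitioned data" (DPVI-VPD) with sampling probability $q$, $T$ iterations, clipping threshold $C$ and noise parameter $\sigma$, in the variant where a trusted third party adds the noise, i.e. $\boldsymbol{\zeta}\sim\mathcal{N}_{\mathbb{Z}}(0,C^2\sigma^2\mathbf{I})$ in each iteration. Then DPVI-VPD is $(\epsilon,\delta)$-differentially private with respect to the outside analyst, where $$\epsilon=\mathcal{O}\bigl(\delta,q,T,\mathcal{N}_{\mathbb{Z}}(0,\sigma^2)\bigr).$$
   Context: Differential privacy. A dataset is $\mathcal{D}=(x_1,\dots,x_N)$; two datasets are adjacent if they differ in one sample (one sample is replaced). A randomised algorithm $\mathcal{A}$ is $(\epsilon,\delta)$-differentially private (DP) if for all adjacent $\mathcal{D},\mathcal{D}'$ and measurable $S$, $\Pr(\mathcal{A}(\mathcal{D})\in S)\le e^{\epsilon}\Pr(\mathcal{A}(\mathcal{D}')\in S)+\delta$. Discrete Gaussian. $\mathcal{N}_{\mathbb{Z}}(0,s^2)$ is the distribution on $\mathbb{Z}$ with mass at $z$ proportional to $\exp(-z^2/(2s^2))$; $\mathcal{N}_{\mathbb{Z}}(0,s^2\mathbf{I})$ on $\mathbb{Z}^d$ has i.i.d. such coordinates. Base mechanism. As an argument of the oracle, $\mathcal{N}_{\mathbb{Z}}(0,\sigma^2)$ denotes the discrete Gaussian mechanism with noise parameter $\sigma$ relative to the clipping threshold $C$: given a per-example function $f$ (possibly depending on the index) with values in $\{v\in\mathbb{Z}^d:\|v\|_2\le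 C\}$ and a set $B$ of indices, it outputs $\sum_{i\in B}f(i,x_i)+\boldsymbol{\zeta}$ with $\boldsymbol{\zeta}\sim\mathcal{N}_{\mathbb{Z}}(0,C^2\sigma^2\mathbf{I})$. With sub-sampling ratio $q$, $B\subseteq\{1,\dots,N\}$ is random, each index being included independently with probability $q$, and $B$ is not output. A $T$-fold composition runs the mechanism $T$ times with fresh independent noise and sub-samples, releases all outputs, and allows the per-example function of each step to depend on previous outputs and on data-independent randomness. Accounting oracle. An accounting oracle is a function $\mathcal{O}:(\delta,q,T,\mathcal{A})\mapsto\epsilon$ such that every $T$-fold composition of the base mechanism $\mathcal{A}$ with sub-sampling ratio $q$ is $(\epsilon,\delta)$-DP. Algorithm DPVI-VPD. Each sample is split over $P$ parties as $x_n=(x_n^1,\dots,x_n^P)$, party $p$ holding $x_n^p$ for all $n$. The model is a $K$-component mixture with weights $\pi_k$ and component densities $\prod_{p=1}^P\mathcal{F}_p(x_n^p\mid\rho_k^p)$. All vectors entering the multiparty computation (MPC) are in fixed-point representation, i.e. (after scaling) integer vectors obtained by truncation towards zero, with $C$ measured in the same units. In each iteration $t=1,\dots,T$, with current parameters $(\pi,\rho)=(\pi^{(t)},\rho^{(t)})$: 1. A random subset $B\subseteq\{1,\dots,N\}$ is drawn, each index being included independently with probability $q$. 2. For each $n\in B$, under MPC, the per-example gradient vector $g_t(x_n)$ is formed; its entries are, for all $k,p$, $$\frac{\prod_{p'}\mathcal{F}_{p'}(x_n^{p'}\mid\rho_k^{p'})}{\sum_{l}\pi_l\prod_{p'}\mathcal{F}_{p'}(x_n^{p'}\mid\rho_l^{p'})}\quad\text{and}\quad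 \frac{\pi_k\,\frac{\partial \mathcal{F}_p(x_n^p\mid\rho_k^p)}{\partial\rho_k^p}\prod_{p'\ne p}\mathcal{F}_{p'}(x_n^{p'}\mid\rho_k^{p'})}{\sum_{l}\pi_l\prod_{p'}\mathcal{F}_{p'}(x_n^{p'}\mid\rho_l^{p'})}.$$ 3. It is clipped: $g_t^*(x_n)=g_t(x_n)/\max(1,\|g_t(x_n)\|_2/C)$ (in integer representation, so $\|g_t^*(x_n)\|_2\le C$). 4. The vector $\tilde g_t=\sum_{n\in B}g_t^*(x_n)+\boldsymbol{\zeta}$, with fresh noise $\boldsymbol{\zeta}$, is decrypted and released. 5. The data-independent log-prior and entropy gradients are added to $\tilde g_t$, and $(\pi,\rho)$ is updated using the result (and data-independent randomness). The MPC is ideal: it reveals nothing except the released values. The outside analyst observes the released values $\tilde g_1,\dots,\tilde g_T$ (hence also the parameters) and not the subsets $B$ or the noise. "DP with respect to the outside analyst" means that the randomised map from $\mathcal{D}$ to what the analyst observes is DP. *)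

theory Defs
  imports "HOL-Probability.Probability"
begin

definition adjacent :: "'x list \<Rightarrow> 'x list \<Rightarrow> bool" where
  "adjacent D D' \<longleftrightarrow> (\<exists>i < length D. \<exists>x. D' = D[i := x])"

text \<open>The privacy parameter \<open>\<epsilon>\<close> may be infinite, in which case nothing is demanded. An accountant
  needs this value: with \<open>\<delta> = 0\<close>, for instance, the (sub-sampled) discrete Gaussian mechanism
  has in general no finite \<open>\<epsilon>\<close>.\<close>

definition differentially_private ::
    "ennreal \<Rightarrow> real \<Rightarrow> ('x list \<Rightarrow> 'o measure) \<Rightarrow> bool" where
  "differentially_private \<epsilon> \<delta> M \<longleftrightarrow>
     \<epsilon> = \<top> \<or>
     (\<forall>D D'. adjacent D D' \<longrightarrow>
        (\<forall>S \<in> sets (M D). measure (M D) S \<le> exp (enn2real \<epsilon>) * measure (M D') S + \<delta>))"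

definition discrete_gaussian :: "real \<Rightarrow> int pmf" where
  "discrete_gaussian s =
     embed_pmf (\<lambda>z. exp (- (real_of_int z)\<^sup>2 / (2 * s\<^sup>2)) /
                    (\<Sum>\<^sub>\<infinity>w\<in>UNIV. exp (- (real_of_int w)\<^sup>2 / (2 * s\<^sup>2))))"

text \<open>The function given to \<^const>\<open>embed_pmf\<close> is a probability mass function for \<open>s > 0\<close>:\<close>

lemma summable_discrete_gaussian:
  assumes "s > 0"
  shows "(\<lambda>z::int. exp (- (real_of_int z)\<^sup>2 / (2 * s\<^sup>2))) summable_on UNIV"
proof -
  let ?g = "\<lambda>z::int. exp (- (real_of_int z)\<^sup>2 / (2 * s\<^sup>2))"
  define r where "r = exp (- 1 / (2 * s\<^sup>2))"
  have r: "0 < r" "r < 1" using assms by (auto simp: r_def)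
  have "summable (\<lambda>n. norm (r ^ n))"
    using r by (simp add: summable_geometric)
  then have geo: "(\<lambda>n. r ^ n) summable_on (UNIV :: nat set)"
    by (rule norm_summable_imp_summable_on)
  have bound: "?g z \<le> r ^ nat \<bar>z\<bar>" for z
  proof -
    have "r ^ nat \<bar>z\<bar> = exp (real (nat \<bar>z\<bar>) * (- 1 / (2 * s\<^sup>2)))"
      unfolding r_def by (rule exp_of_nat_mult [symmetric])
    moreover have "\<bar>z\<bar> \<le> z\<^sup>2"
      using self_le_power[of "\<bar>z\<bar>" 2] by (cases "z = 0") auto
    then have "real (nat \<bar>z\<bar>) \<le> (real_of_int z)\<^sup>2"
      by (metis abs_ge_zero nat_0_le of_int_le_iff of_int_of_nat_eq of_int_power)
    then have "- (real_of_int z)\<^sup>2 / (2 * s\<^sup>2) \<le> real (nat \<bar>z\<bar>) * (- 1 / (2 * s\<^sup>2))"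
      using assms by (simp add: field_simps)
    ultimately show ?thesis by simp
  qed
  have half: "?g summable_on (f ` UNIV)" if f: "f = int \<or> f = (\<lambda>n. - int n)" for f
  proof -
    have inj: "inj f" using f by (auto simp: inj_def)
    have "(\<lambda>n. ?g (f n)) summable_on UNIV"
    proof (rule summable_on_comparison_test[OF geo])
      fix n show "?g (f n) \<le> r ^ n" using bound[of "f n"] f by auto
    qed auto
    then show ?thesis using summable_on_reindex[OF inj, of ?g] by (simp add: o_def)
  qed
  have "(UNIV :: int set) = int ` UNIV \<union> (\<lambda>n. - int n) ` UNIV"
    by (auto intro: int_cases2)
  then show ?thesis
    using half by (metis (no_types, lifting) summable_on_union)
qed

lemma pmf_discrete_gaussian:
  assumes "s > 0"
  shows "pmf (discrete_gaussian s) z =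
           exp (- (real_of_int z)\<^sup>2 / (2 * s\<^sup>2)) /
           (\<Sum>\<^sub>\<infinity>w\<in>UNIV. exp (- (real_of_int w)\<^sup>2 / (2 * s\<^sup>2)))"
proof -
  let ?g = "\<lambda>z::int. exp (- (real_of_int z)\<^sup>2 / (2 * s\<^sup>2))"
  let ?Z = "infsum ?g UNIV"
  have sg: "?g summable_on UNIV" by (rule summable_discrete_gaussian[OF assms])
  have "?g 0 \<le> ?Z"
    using finite_sum_le_infsum[OF sg, of "{0}"] by simp
  then have Z: "?Z > 0" by simp
  have s1: "(\<lambda>z. ?g z / ?Z) summable_on UNIV"
    using summable_on_cmult_left[OF sg, of "1 / ?Z"] by simp
  then have s2: "integrable (count_space UNIV) (\<lambda>z. ?g z / ?Z)"
    using Z abs_summable_equivalent[of "\<lambda>z. ?g z / ?Z" UNIV] by (simp add: abs_summable_on_def)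
  have "(\<integral>\<^sup>+z. ennreal (?g z / ?Z) \<partial>count_space UNIV) = ennreal (infsum (\<lambda>z. ?g z / ?Z) UNIV)"
    using s2 Z infsetsum_infsum[of "\<lambda>z. ?g z / ?Z" UNIV]
    by (subst nn_integral_conv_infsetsum) (auto simp: abs_summable_on_def)
  also have "infsum (\<lambda>z. ?g z / ?Z) UNIV = 1"
    using Z infsum_cmult_left'[of ?g "1 / ?Z" UNIV] by simp
  finally show ?thesis
    unfolding discrete_gaussian_def using Z by (intro pmf_embed_pmf) auto
qed

text \<open>Vectors over a finite coordinate set \<open>J\<close> are functions that vanish outside \<open>J\<close>.\<close>

definition discrete_gaussian_vec :: "'c set \<Rightarrow> real \<Rightarrow> ('c \<Rightarrow> int) pmf" where
  "discrete_gaussian_vec J s = Pi_pmf J 0 (\<lambda>_. discrete_gaussian s)"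

definition l2_norm :: "'c set \<Rightarrow> ('c \<Rightarrow> int) \<Rightarrow> real" where
  "l2_norm J v = L2_set (\<lambda>j. real_of_int (v j)) J"

definition int_ball :: "'c set \<Rightarrow> real \<Rightarrow> ('c \<Rightarrow> int) set" where
  "int_ball J C = {v. (\<forall>j. j \<notin> J \<longrightarrow> v j = 0) \<and> l2_norm J v \<le> C}"

definition poisson_batch :: "real \<Rightarrow> nat \<Rightarrow> nat set pmf" where
  "poisson_batch q N = map_pmf (\<lambda>b. {i. b i}) (Pi_pmf {..<N} False (\<lambda>_. bernoulli_pmf q))"

text \<open>A mechanism gets the dimension \<open>d\<close>, the clipping threshold \<open>C\<close>, the batch \<open>B\<close>
  and, for \<open>i \<in> B\<close>, the integer vector \<open>f (i, x\<^sub>i)\<close>, with coordinate set \<open>{..<d}\<close>.\<close>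

type_synonym mechanism =
  "nat \<Rightarrow> real \<Rightarrow> nat set \<Rightarrow> (nat \<Rightarrow> nat \<Rightarrow> int) \<Rightarrow> (nat \<Rightarrow> int) pmf"

definition discrete_gaussian_mechanism :: "real \<Rightarrow> mechanism" where
  "discrete_gaussian_mechanism \<sigma> d C B v =
     map_pmf (\<lambda>\<zeta> j. (\<Sum>i\<in>B. v i j) + \<zeta> j) (discrete_gaussian_vec {..<d} (C * \<sigma>))"

text \<open>The per-example function of a step takes the list of all previous outputs, whose length
  is the number of the step (from 0), the index of the example, and the example.\<close>

primrec adaptive_outputs ::
    "mechanism \<Rightarrow> nat \<Rightarrow> real \<Rightarrow> real \<Rightarrow> ((nat \<Rightarrow> int) list \<Rightarrow> nat \<Rightarrow> 'x \<Rightarrow> nat \<Rightarrow> int) \<Rightarrow>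
     'x list \<Rightarrow> nat \<Rightarrow> (nat \<Rightarrow> int) list pmf" where
  "adaptive_outputs A d C q f D 0 = return_pmf []"
| "adaptive_outputs A d C q f D (Suc t) = do {
     ys \<leftarrow> adaptive_outputs A d C q f D t;
     B \<leftarrow> poisson_batch q (length D);
     y \<leftarrow> A d C B (\<lambda>i\<in>B. f ys i (D ! i));
     return_pmf (ys @ [y])
   }"

text \<open>The data-independent randomness \<open>\<omega>\<close> of all steps is drawn from \<open>W\<close> in advance; taking
  a product measure for \<open>W\<close> gives fresh independent randomness in each step.\<close>

definition composition ::
    "mechanism \<Rightarrow> nat \<Rightarrow> real \<Rightarrow> real \<Rightarrow> nat \<Rightarrow> 'w measure \<Rightarrow>
     ('w \<Rightarrow> (nat \<Rightarrow> int) list \<Rightarrow> nat \<Rightarrow> 'x \<Rightarrow> nat \<Rightarrow> int) \<Rightarrow>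
     'x list \<Rightarrow> (nat \<Rightarrow> int) list measure" where
  "composition A d C q T W f D = W \<bind> (\<lambda>\<omega>. measure_pmf (adaptive_outputs A d C q (f \<omega>) D T))"

definition per_example_functions ::
    "nat \<Rightarrow> real \<Rightarrow> 'w measure \<Rightarrow> ('w \<Rightarrow> (nat \<Rightarrow> int) list \<Rightarrow> nat \<Rightarrow> 'x \<Rightarrow> nat \<Rightarrow> int) \<Rightarrow> bool" where
  "per_example_functions d C W f \<longleftrightarrow>
     (\<forall>ys i x. (\<lambda>\<omega>. f \<omega> ys i x) \<in> W \<rightarrow>\<^sub>M count_space UNIV \<and>
               (\<forall>\<omega> \<in> space W. f \<omega> ys i x \<in> int_ball {..<d} C))"

text \<open>HOL cannot quantify over types inside a formula, so the types of the examples and of the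
  data-independent randomness are parameters; dimension, threshold, dataset size and
  distribution of the randomness are arbitrary.\<close>

definition accounting_oracle ::
    "'x itself \<Rightarrow> 'w itself \<Rightarrow> (real \<Rightarrow> real \<Rightarrow> nat \<Rightarrow> mechanism \<Rightarrow> ennreal) \<Rightarrow> bool" where
  "accounting_oracle _ _ \<O> \<longleftrightarrow>
     (\<forall>\<delta> q T A. 0 \<le> \<delta> \<longrightarrow> 0 \<le> q \<longrightarrow> q \<le> 1 \<longrightarrow>
        (\<forall>d C (W :: 'w measure) (f :: 'w \<Rightarrow> (nat \<Rightarrow> int) list \<Rightarrow> nat \<Rightarrow> 'x \<Rightarrow> nat \<Rightarrow> int).
           0 < C \<longrightarrow> prob_space W \<longrightarrow> per_example_functions d C W f \<longrightarrow>
           differentially_private (\<O> \<delta> q T A) \<delta> (composition A d C q T W f)))"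

text \<open>The components are indexed by \<open>'k\<close> and the parties by \<open>'p\<close>. For a component \<open>k\<close> the party
  parameters \<open>\<rho>\<^sub>k\<^sup>p\<close>, which may have different dimensions, are concatenated to one vector with
  coordinates in \<open>'j\<close>; coordinate \<open>j\<close> belongs to \<open>\<rho>\<^sub>k\<^sup>p\<close> for \<open>p = owner j\<close>. The density \<open>F p y\<close>
  takes the concatenated vector but depends only on the coordinates of party \<open>p\<close>.\<close>

type_synonym ('k, 'j) params = "(real^'k) \<times> (real^'j^'k)"

definition param_space :: "(real^'j) set \<Rightarrow> ('k::finite, 'j::finite) params set" where
  "param_space \<Theta> =
     {(\<pi>, \<rho>). (\<forall>k. 0 \<le> \<pi> $ k) \<and> (\<Sum>k\<in>UNIV. \<pi> $ k) = 1 \<and> (\<forall>k. \<rho> $ k \<in> \<Theta>)}"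

definition component_densities ::
    "('p \<Rightarrow> 'a measure) \<Rightarrow> (real^'j) set \<Rightarrow> ('j::finite \<Rightarrow> 'p) \<Rightarrow> ('p \<Rightarrow> 'a \<Rightarrow> real^'j \<Rightarrow> real) \<Rightarrow> bool"
  where
  "component_densities \<nu> \<Theta> owner F \<longleftrightarrow>
     open \<Theta> \<and>
     (\<forall>p y \<rho> \<rho>'. (\<forall>j. owner j = p \<longrightarrow> \<rho> $ j = \<rho>' $ j) \<longrightarrow> F p y \<rho> = F p y \<rho>') \<and>
     (\<forall>p. \<forall>\<rho>\<in>\<Theta>.
        (\<forall>y. 0 \<le> F p y \<rho>) \<and>
        (\<lambda>y. F p y \<rho>) \<in> borel_measurable (\<nu> p) \<and>
        (\<integral>\<^sup>+y. ennreal (F p y \<rho>) \<partial>\<nu> p) = 1 \<and>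
        (\<forall>y. F p y differentiable (at \<rho>)))"

definition partial_deriv :: "(real^'j \<Rightarrow> real) \<Rightarrow> 'j::finite \<Rightarrow> real^'j \<Rightarrow> real" where
  "partial_deriv h j v = deriv (\<lambda>u. h (v + u *\<^sub>R axis j 1)) 0"

definition mixture_density ::
    "('p::finite \<Rightarrow> 'a \<Rightarrow> real^'j \<Rightarrow> real) \<Rightarrow> ('k::finite, 'j::finite) params \<Rightarrow> ('p \<Rightarrow> 'a) \<Rightarrow> real" where
  "mixture_density F \<theta> x = (\<Sum>l\<in>UNIV. fst \<theta> $ l * (\<Prod>p\<in>UNIV. F p (x p) (snd \<theta> $ l)))"

text \<open>Coordinate \<open>Inl k\<close> belongs to the weight \<open>\<pi>\<^sub>k\<close>, and \<open>Inr (k, j)\<close> to coordinate \<open>j\<close> of \<open>\<rho>\<^sub>k\<close>.\<close>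

definition gradient_entry ::
    "('p::finite \<Rightarrow> 'a \<Rightarrow> real^'j \<Rightarrow> real) \<Rightarrow> ('j::finite \<Rightarrow> 'p) \<Rightarrow> ('k::finite, 'j) params \<Rightarrow>
     ('p \<Rightarrow> 'a) \<Rightarrow> 'k + 'k \<times> 'j \<Rightarrow> real" where
  "gradient_entry F owner \<theta> x c =
     (case c of
        Inl k \<Rightarrow> (\<Prod>p\<in>UNIV. F p (x p) (snd \<theta> $ k)) / mixture_density F \<theta> x
      | Inr (k, j) \<Rightarrow>
          fst \<theta> $ k * partial_deriv (F (owner j) (x (owner j))) j (snd \<theta> $ k) *
          (\<Prod>p\<in>UNIV - {owner j}. F p (x p) (snd \<theta> $ k)) / mixture_density F \<theta> x)"

definition truncate :: "real \<Rightarrow> int" where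
  "truncate u = (if 0 \<le> u then \<lfloor>u\<rfloor> else \<lceil>u\<rceil>)"

definition gradient ::
    "('p::finite \<Rightarrow> 'a \<Rightarrow> real^'j \<Rightarrow> real) \<Rightarrow> ('j::finite \<Rightarrow> 'p) \<Rightarrow> real \<Rightarrow> ('k::finite, 'j) params \<Rightarrow>
     ('p \<Rightarrow> 'a) \<Rightarrow> 'k + 'k \<times> 'j \<Rightarrow> int" where
  "gradient F owner fp_scale \<theta> x c = truncate (fp_scale * gradient_entry F owner \<theta> x c)"

text \<open>The quotient is rounded again to an integer vector; truncation towards zero keeps its norm
  at most \<open>C\<close>.\<close>

definition clip :: "real \<Rightarrow> ('c \<Rightarrow> int) \<Rightarrow> 'c \<Rightarrow> int" where
  "clip C v c = truncate (real_of_int (v c) / max 1 (l2_norm UNIV v / C))"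

text \<open>One run for given data-independent randomness \<open>\<omega>\<close>: the released vectors together with the
  initial and all updated parameters. The vector \<open>reg t \<omega> \<theta>\<close> holds the log-prior and
  entropy gradients; \<open>fp_scale\<close> is the number of fixed-point units per 1.\<close>

primrec dpvi_vpd_run ::
    "('p::finite \<Rightarrow> 'a \<Rightarrow> real^'j \<Rightarrow> real) \<Rightarrow> ('j::finite \<Rightarrow> 'p) \<Rightarrow> real \<Rightarrow> real \<Rightarrow> real \<Rightarrow> real \<Rightarrow>
     ('w \<Rightarrow> ('k::finite, 'j) params) \<Rightarrow>
     (nat \<Rightarrow> 'w \<Rightarrow> ('k, 'j) params \<Rightarrow> real^('k + 'k \<times> 'j)) \<Rightarrow>
     (nat \<Rightarrow> 'w \<Rightarrow> ('k, 'j) params \<Rightarrow> real^('k + 'k \<times> 'j) \<Rightarrow> ('k, 'j) params) \<Rightarrow>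
     'w \<Rightarrow> ('p \<Rightarrow> 'a) list \<Rightarrow> nat \<Rightarrow>
     (('k + 'k \<times> 'j \<Rightarrow> int) list \<times> ('k, 'j) params list) pmf" where
  "dpvi_vpd_run F owner fp_scale C \<sigma> q init reg update \<omega> D 0 = return_pmf ([], [init \<omega>])"
| "dpvi_vpd_run F owner fp_scale C \<sigma> q init reg update \<omega> D (Suc t) = do {
     (gs, \<theta>s) \<leftarrow> dpvi_vpd_run F owner fp_scale C \<sigma> q init reg update \<omega> D t;
     let \<theta> = last \<theta>s;
     B \<leftarrow> poisson_batch q (length D);
     \<zeta> \<leftarrow> discrete_gaussian_vec UNIV (C * \<sigma>);
     let g = (\<lambda>c. (\<Sum>n\<in>B. clip C (gradient F owner fp_scale \<theta> (D ! n)) c) + \<zeta> c);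
     let v = (\<chi> c. real_of_int (g c) / fp_scale) + reg t \<omega> \<theta>;
     return_pmf (gs @ [g], \<theta>s @ [update t \<omega> \<theta> v])
   }"

definition dpvi_vpd_view ::
    "('p::finite \<Rightarrow> 'a \<Rightarrow> real^'j \<Rightarrow> real) \<Rightarrow> ('j::finite \<Rightarrow> 'p) \<Rightarrow> real \<Rightarrow> real \<Rightarrow> real \<Rightarrow> real \<Rightarrow>
     nat \<Rightarrow> 'w measure \<Rightarrow>
     ('w \<Rightarrow> ('k::finite, 'j) params) \<Rightarrow>
     (nat \<Rightarrow> 'w \<Rightarrow> ('k, 'j) params \<Rightarrow> real^('k + 'k \<times> 'j)) \<Rightarrow>
     (nat \<Rightarrow> 'w \<Rightarrow> ('k, 'j) params \<Rightarrow> real^('k + 'k \<times> 'j) \<Rightarrow> ('k, 'j) params) \<Rightarrow>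
     ('p \<Rightarrow> 'a) list \<Rightarrow>
     (('k + 'k \<times> 'j \<Rightarrow> int) list \<times> (nat \<Rightarrow> ('k, 'j) params)) measure" where
  "dpvi_vpd_view F owner fp_scale C \<sigma> q T W init reg update D =
     W \<bind> (\<lambda>\<omega>. distr (measure_pmf (dpvi_vpd_run F owner fp_scale C \<sigma> q init reg update \<omega> D T))
                 (count_space UNIV \<Otimes>\<^sub>M (\<Pi>\<^sub>M t\<in>{..T}. borel))
                 (\<lambda>(gs, \<theta>s). (gs, \<lambda>t\<in>{..T}. \<theta>s ! t)))"

end

theory Submission
  imports Defs
begin

text \<open>For a fixed value of the data-independent randomness, the parameters are a deterministic
  function of the released vectors, and these are the output of an adaptive composition of the
  sub-sampled discrete Gaussian mechanism, whose per-example functions (the clipped gradients) have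
  norm at most \<open>C\<close>. The parameters also depend on the randomness itself, so privacy of the
  released vectors averaged over the randomness does not suffice. The oracle, however, covers
  point masses as distributions of the randomness; this yields the privacy inequality for each of
  its values, with a common \<open>\<epsilon>\<close>, and integrating over the randomness preserves it.\<close>

section \<open>Norm of clipped integer vectors\<close>

lemma abs_truncate_le: "\<bar>real_of_int (truncate u)\<bar> \<le> \<bar>u\<bar>"
proof (cases "0 \<le> u")
  case True
  then show ?thesis by (simp add: truncate_def)
next
  case False
  then have "real_of_int \<lceil>u\<rceil> \<le> 0" by simp
  with False show ?thesis by (simp add: truncate_def)
qed

text \<open>Division by \<open>max 1 (l2_norm UNIV v / C)\<close> brings the norm down to at most
  \<open>C\<close>, and truncation towards zero shrinks every coordinate in absolute value, so
  rounding the quotient cannot leave the ball.\<close>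

lemma l2_norm_clip_le:
  fixes v :: "'c::finite \<Rightarrow> int"
  assumes "0 < C"
  shows "l2_norm UNIV (clip C v) \<le> C"
proof -
  define m where "m = max 1 (l2_norm UNIV v / C)"
  have m: "m > 0" "l2_norm UNIV v / C \<le> m"
    by (auto simp: m_def)
  have "l2_norm UNIV (clip C v) = L2_set (\<lambda>j. \<bar>real_of_int (clip C v j)\<bar>) UNIV"
    by (simp add: l2_norm_def L2_set_def)
  also have "\<dots> \<le> L2_set (\<lambda>j. 1 / m * \<bar>real_of_int (v j)\<bar>) UNIV"
  proof (rule L2_set_mono)
    fix j
    have "\<bar>real_of_int (clip C v j)\<bar> \<le> \<bar>real_of_int (v j) / m\<bar>"
      unfolding clip_def m_def by (rule abs_truncate_le)
    then show "\<bar>real_of_int (clip C v j)\<bar> \<le> 1 / m * \<bar>real_of_int (v j)\<bar>"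
      using m by simp
  qed simp
  also have "\<dots> = 1 / m * l2_norm UNIV v"
    using m by (subst L2_set_right_distrib [symmetric]) (auto simp: l2_norm_def L2_set_def)
  also have "\<dots> \<le> C"
    using m assms by (simp add: field_simps)
  finally show ?thesis .
qed

section \<open>Released vectors as an adaptive composition\<close>

lemma set_pmf_poisson_batch: "set_pmf (poisson_batch q N) \<subseteq> Pow {..<N}"
  using set_Pi_pmf_subset[of "{..<N}" False "\<lambda>_. bernoulli_pmf q"]
  by (auto simp: poisson_batch_def)

text \<open>The per-example vectors come as an evaluated list: for finite \<open>'c\<close> a step
  then depends on the randomness only through a value of a countable type, which makes its
  measurability easy.\<close>

definition noisy_sum :: "real \<Rightarrow> real \<Rightarrow> real \<Rightarrow> ('c \<Rightarrow> int) list \<Rightarrow> ('c \<Rightarrow> int) pmf" where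
  "noisy_sum C \<sigma> q vs = do {
     B \<leftarrow> poisson_batch q (length vs);
     \<zeta> \<leftarrow> discrete_gaussian_vec UNIV (C * \<sigma>);
     return_pmf (\<lambda>c. (\<Sum>n\<in>B. (vs ! n) c) + \<zeta> c)
   }"

text \<open>No parameters are carried along; \<open>h\<close> recovers what it needs from the
  earlier outputs, including the number of the step, which is their length.\<close>

primrec released :: "real \<Rightarrow> real \<Rightarrow> real \<Rightarrow> (('c \<Rightarrow> int) list \<Rightarrow> 'x \<Rightarrow> 'c \<Rightarrow> int) \<Rightarrow> 'x list \<Rightarrow> nat
    \<Rightarrow> ('c \<Rightarrow> int) list pmf" where
  "released C \<sigma> q h D 0 = return_pmf []"
| "released C \<sigma> q h D (Suc t) = do {
     gs \<leftarrow> released C \<sigma> q h D t;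
     g \<leftarrow> noisy_sum C \<sigma> q (map (h gs) D);
     return_pmf (gs @ [g])
   }"

lemma length_released: "gs \<in> set_pmf (released C \<sigma> q h D t) \<Longrightarrow> length gs = t"
  by (induction t arbitrary: gs) auto

text \<open>Mechanisms use numbers below \<open>d\<close> as coordinates, gradients use
  \<open>'c\<close>. Renumbering along \<open>e\<close> commutes with the sums, and i.i.d. noise
  keeps its law under it.\<close>

lemma released_eq_map_adaptive_outputs:
  fixes h :: "('c::finite \<Rightarrow> int) list \<Rightarrow> 'x \<Rightarrow> 'c \<Rightarrow> int"
  assumes e: "bij_betw e (UNIV :: 'c set) {..<d}"
  shows "released C \<sigma> q h D t =
    map_pmf (map (\<lambda>y. y \<circ> e))
      (adaptive_outputs (discrete_gaussian_mechanism \<sigma>) d C q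
         (\<lambda>ys _ x j. if j < d then h (map (\<lambda>y. y \<circ> e) ys) x (the_inv_into UNIV e j) else 0) D t)"
    (is "_ = map_pmf (map ?dec) (adaptive_outputs _ _ _ _ ?f _ _)")
proof (induction t)
  case (Suc t)
  have e': "e c < d" "the_inv_into UNIV e (e c) = c" for c
    using e by (auto simp: bij_betw_def the_inv_into_f_f)
  have noise: "discrete_gaussian_vec UNIV s = map_pmf ?dec (discrete_gaussian_vec {..<d} s)" for s
    unfolding discrete_gaussian_vec_def by (rule Pi_pmf_bij_betw[OF _ e]) auto
  have step: "noisy_sum C \<sigma> q (map (h (map ?dec ys)) D) =
      poisson_batch q (length D) \<bind> (\<lambda>B.
        map_pmf ?dec (discrete_gaussian_mechanism \<sigma> d C B (\<lambda>i\<in>B. ?f ys i (D ! i))))" for ys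
    unfolding noisy_sum_def length_map
  proof (rule bind_pmf_cong[OF refl])
    fix B assume "B \<in> set_pmf (poisson_batch q (length D))"
    then have B: "i < length D" if "i \<in> B" for i
      using set_pmf_poisson_batch that by blast
    \<comment> \<open>Batch members are valid indices, so \<open>nth\<close> of \<open>map\<close>
      can be evaluated; \<open>restrict\<close> changes nothing on \<open>B\<close>.\<close>
    have sum: "(\<Sum>n\<in>B. (map (h (map ?dec ys)) D ! n) c) =
        (\<Sum>i\<in>B. restrict (\<lambda>i. ?f ys i (D ! i)) B i (e c))" for c
      by (rule sum.cong) (auto simp: B e')
    show "discrete_gaussian_vec UNIV (C * \<sigma>) \<bind>
        (\<lambda>\<zeta>. return_pmf (\<lambda>c. (\<Sum>n\<in>B. (map (h (map ?dec ys)) D ! n) c) + \<zeta> c)) =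
      map_pmf ?dec (discrete_gaussian_mechanism \<sigma> d C B (\<lambda>i\<in>B. ?f ys i (D ! i)))"
      unfolding discrete_gaussian_mechanism_def noise sum
      by (simp add: map_pmf_def bind_assoc_pmf bind_return_pmf o_def)
  qed
  show ?case
    unfolding released.simps adaptive_outputs.simps Suc bind_map_pmf step
    by (simp add: map_pmf_def bind_assoc_pmf bind_return_pmf o_def)
qed simp

text \<open>Renumbering only permutes the summands of the norm, and the value 0 from
  \<open>d\<close> on meets the support condition of \<open>int_ball\<close>. Measurability is
  immediate, since the function ignores the randomness.\<close>

lemma per_example_functions_adaptive:
  fixes h :: "('c::finite \<Rightarrow> int) list \<Rightarrow> 'x \<Rightarrow> 'c \<Rightarrow> int"
  assumes e: "bij_betw e (UNIV :: 'c set) {..<d}" and h: "\<And>gs x. l2_norm UNIV (h gs x) \<le> C"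
  shows "per_example_functions d C W
    (\<lambda>_ ys _ x j. if j < d then h (map (\<lambda>y. y \<circ> e) ys) x (the_inv_into UNIV e j) else 0)"
proof -
  have e': "e c < d" "the_inv_into UNIV e (e c) = c" for c
    using e by (auto simp: bij_betw_def the_inv_into_f_f)
  have "l2_norm {..<d} (\<lambda>j. if j < d then v (the_inv_into UNIV e j) else 0) = l2_norm UNIV v" for v
    unfolding l2_norm_def L2_set_def
    by (subst sum.reindex_bij_betw[OF e, symmetric]) (simp add: e')
  then show ?thesis
    using h by (auto simp: per_example_functions_def int_ball_def)
qed

text \<open>For a deterministic \<open>h\<close> the oracle applies to the renumbered composition,
  and undoing the renumbering is post-processing.\<close>

lemma released_private:
  fixes h :: "('c::finite \<Rightarrow> int) list \<Rightarrow> 'x \<Rightarrow> 'c \<Rightarrow> int"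
    and \<O> :: "real \<Rightarrow> real \<Rightarrow> nat \<Rightarrow> mechanism \<Rightarrow> ennreal"
  assumes \<O>: "accounting_oracle TYPE('x) TYPE('w) \<O>"
    and "0 \<le> \<delta>" "0 \<le> q" "q \<le> 1" "0 < C"
    and h: "\<And>gs x. l2_norm UNIV (h gs x) \<le> C"
  shows "differentially_private (\<O> \<delta> q T (discrete_gaussian_mechanism \<sigma>)) \<delta>
    (\<lambda>D. measure_pmf (released C \<sigma> q h D T))"
proof -
  define d where "d = CARD('c)"
  obtain e where e: "bij_betw e (UNIV :: 'c set) {..<d}"
    using ex_bij_betw_finite_nat[of "UNIV :: 'c set"] by (auto simp: d_def atLeast0LessThan)
  \<comment> \<open>The oracle speaks of distributions on \<open>'w\<close>; a point mass anywhere
    will do, as the per-example function is constant in the randomness.\<close>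
  define W :: "'w measure" where "W = return (count_space UNIV) undefined"
  define f where "f = (\<lambda>ys (_::nat) x j.
    if j < d then h (map (\<lambda>y. y \<circ> e) ys) x (the_inv_into UNIV e j) else 0)"
  have "prob_space W"
    unfolding W_def by (rule prob_space_return) simp
  moreover have "per_example_functions d C W (\<lambda>_. f)"
    unfolding f_def by (rule per_example_functions_adaptive[OF e h])
  ultimately have "differentially_private (\<O> \<delta> q T (discrete_gaussian_mechanism \<sigma>)) \<delta>
      (composition (discrete_gaussian_mechanism \<sigma>) d C q T W (\<lambda>_. f))"
    using \<O> assms(2-5) unfolding accounting_oracle_def by blast
  moreover have "composition (discrete_gaussian_mechanism \<sigma>) d C q T W (\<lambda>_. f) D =
      measure_pmf (adaptive_outputs (discrete_gaussian_mechanism \<sigma>) d C q f D T)" for D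
    unfolding composition_def W_def
    by (rule bind_return[where N = "count_space UNIV"])
       (auto simp: space_subprob_algebra measure_pmf.subprob_space_axioms)
  \<comment> \<open>Post-processing: a set of decoded outputs has the probability of its preimage,
    and every set of lists is an event.\<close>
  ultimately show ?thesis
    unfolding differentially_private_def released_eq_map_adaptive_outputs[OF e] f_def[symmetric]
    by (auto simp: measure_map_pmf)
qed

section \<open>Measurability in the data-independent randomness\<close>

lemma measurable_map_list:
  fixes h :: "'w \<Rightarrow> 'x \<Rightarrow> 'b::countable"
  assumes "\<And>x. (\<lambda>\<omega>. h \<omega> x) \<in> W \<rightarrow>\<^sub>M count_space UNIV"
  shows "(\<lambda>\<omega>. map (h \<omega>) D) \<in> W \<rightarrow>\<^sub>M count_space UNIV"
proof (induction D)
  case (Cons x D)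
  have "(\<lambda>\<omega>. y # map (h \<omega>) D) \<in> W \<rightarrow>\<^sub>M count_space UNIV" for y
    by (rule measurable_compose[OF Cons]) simp
  then show ?case
    using measurable_compose_countable[of "\<lambda>y \<omega>. y # map (h \<omega>) D", OF _ assms] by simp
qed simp

text \<open>For fixed earlier outputs a step sees the randomness only through a list of integer
  vectors. The earlier outputs range over a countable type, so fixing them suffices for a joint
  kernel, and binding preserves measurability.\<close>

lemma measurable_released:
  fixes h :: "'w \<Rightarrow> ('c::finite \<Rightarrow> int) list \<Rightarrow> 'x \<Rightarrow> 'c \<Rightarrow> int"
  assumes "\<And>gs x. (\<lambda>\<omega>. h \<omega> gs x) \<in> W \<rightarrow>\<^sub>M count_space UNIV"
  shows "(\<lambda>\<omega>. measure_pmf (released C \<sigma> q (h \<omega>) D t)) \<in> W \<rightarrow>\<^sub>M subprob_algebra (count_space UNIV)"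
proof (induction t)
  case (Suc t)
  have "(\<lambda>\<omega>. measure_pmf (noisy_sum C \<sigma> q (map (h \<omega> gs) D) \<bind> (\<lambda>g. return_pmf (gs @ [g]))))
      \<in> W \<rightarrow>\<^sub>M subprob_algebra (count_space UNIV)" for gs
    by (rule measurable_compose[OF measurable_map_list[OF assms]])
       (auto simp: space_subprob_algebra measure_pmf.subprob_space_axioms)
  then have "case_prod (\<lambda>\<omega> gs. measure_pmf
      (noisy_sum C \<sigma> q (map (h \<omega> gs) D) \<bind> (\<lambda>g. return_pmf (gs @ [g]))))
      \<in> W \<Otimes>\<^sub>M count_space UNIV \<rightarrow>\<^sub>M subprob_algebra (count_space UNIV)"
    unfolding case_prod_beta
    by (rule measurable_compose_countable[where g = snd, OF measurable_compose[OF measurable_fst]])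
       simp_all
  then show ?case
    using measurable_bind'[OF Suc] by (simp add: measure_pmf_bind)
qed simp

lemma measurable_truncate: "truncate \<in> borel \<rightarrow>\<^sub>M count_space UNIV"
  unfolding truncate_def by measurable

text \<open>On \<open>space W\<close> the values of \<open>r\<close> lie in \<Theta>, so
  \<open>r\<close> is measurable into the Borel space restricted to \<Theta>, where continuity on
  \<Theta> is enough.\<close>

lemma borel_measurable_compose_continuous_on:
  fixes h :: "'b::topological_space \<Rightarrow> real"
  assumes "continuous_on \<Theta> h" "r \<in> W \<rightarrow>\<^sub>M borel" "\<And>\<omega>. \<omega> \<in> space W \<Longrightarrow> r \<omega> \<in> \<Theta>"
  shows "(\<lambda>\<omega>. h (r \<omega>)) \<in> borel_measurable W"
  by (rule measurable_compose[OF measurable_restrict_space2[OF _ assms(2)]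
        borel_measurable_continuous_on_restrict[OF assms(1)]]) (use assms(3) in auto)

text \<open>The partial derivative is a pointwise limit of measurable difference quotients, taken
  with the steps \<open>1 / real (Suc n)\<close>.\<close>

lemma borel_measurable_partial_deriv:
  fixes h :: "real^'j::finite \<Rightarrow> real"
  assumes \<Theta>: "open \<Theta>" and h: "\<And>\<rho>. \<rho> \<in> \<Theta> \<Longrightarrow> h differentiable (at \<rho>)"
    and r[measurable]: "r \<in> W \<rightarrow>\<^sub>M borel" and r\<Theta>: "\<And>\<omega>. \<omega> \<in> space W \<Longrightarrow> r \<omega> \<in> \<Theta>"
  shows "(\<lambda>\<omega>. partial_deriv h j (r \<omega>)) \<in> borel_measurable W"
proof -
  \<comment> \<open>\<open>h\<close> need not be Borel outside \<open>\<Theta>\<close>, so the difference quotients are taken of \<open>H\<close>.\<close>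
  define H where "H = (\<lambda>\<rho>. if \<rho> \<in> \<Theta> then h \<rho> else 0)"
  have [measurable]: "H \<in> borel_measurable borel"
    unfolding H_def using h \<Theta>
    by (intro borel_measurable_continuous_on_if)
       (auto simp: differentiable_imp_continuous_within continuous_at_imp_continuous_on)
  define u where "u = (\<lambda>n \<omega>. (H (r \<omega> + (1 / real (Suc n)) *\<^sub>R axis j 1) - H (r \<omega>)) / (1 / real (Suc n)))"
  have [measurable]: "u n \<in> borel_measurable W" for n
    unfolding u_def by measurable
  have "(\<lambda>n. u n \<omega>) \<longlonglongrightarrow> partial_deriv h j (r \<omega>)" if \<omega>: "\<omega> \<in> space W" for \<omega>
  proof -
    let ?l = "\<lambda>s. r \<omega> + s *\<^sub>R axis j (1::real)"
    have "h differentiable (at (?l 0))"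
      using h r\<Theta> \<omega> by simp
    moreover have "?l differentiable (at 0)"
      by simp
    ultimately have "(h \<circ> ?l) differentiable (at 0)"
      by (intro differentiable_chain_at)
    then have "((\<lambda>s. h (?l s)) has_real_derivative partial_deriv h j (r \<omega>)) (at 0)"
      unfolding partial_deriv_def o_def by (metis DERIV_deriv_iff_real_differentiable)
    then have "((\<lambda>s. (h (?l s) - h (r \<omega>)) / s) \<longlongrightarrow> partial_deriv h j (r \<omega>)) (at 0)"
      by (simp add: DERIV_def)
    moreover have "filterlim (\<lambda>n. 1 / real (Suc n)) (at 0) sequentially"
      by (rule filterlim_atI[OF LIMSEQ_Suc[OF lim_1_over_n]]) auto
    ultimately have lim: "(\<lambda>n. (h (?l (1 / real (Suc n))) - h (r \<omega>)) / (1 / real (Suc n)))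
        \<longlonglongrightarrow> partial_deriv h j (r \<omega>)"
      by (rule filterlim_compose)
    \<comment> \<open>As \<Theta> is open, small steps stay inside it, and there \<open>H\<close>
      agrees with \<open>h\<close>.\<close>
    have "(\<lambda>n. ?l (1 / real (Suc n))) \<longlonglongrightarrow> ?l 0"
      by (intro tendsto_intros LIMSEQ_Suc[OF lim_1_over_n])
    then have "\<forall>\<^sub>F n in sequentially. ?l (1 / real (Suc n)) \<in> \<Theta>"
      using \<Theta> r\<Theta> \<omega> by (auto elim!: topological_tendstoD)
    then have "\<forall>\<^sub>F n in sequentially.
        (h (?l (1 / real (Suc n))) - h (r \<omega>)) / (1 / real (Suc n)) = u n \<omega>"
      by eventually_elim (use r\<Theta> \<omega> in \<open>simp add: u_def H_def\<close>)
    with lim show ?thesis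
      by (rule Lim_transform_eventually)
  qed
  then show ?thesis
    by (rule borel_measurable_LIMSEQ_real) measurable
qed

text \<open>In the parameters, the densities are measurable by continuity and their partial
  derivatives as limits. A vanishing mixture density does no harm: the quotient is then 0, and real
  division is Borel measurable.\<close>

lemma measurable_gradient:
  fixes F :: "'p::finite \<Rightarrow> 'a \<Rightarrow> real^'j::finite \<Rightarrow> real"
    and \<theta> :: "'w \<Rightarrow> ('k::finite, 'j) params"
  assumes F: "component_densities \<nu> \<Theta> owner F"
    and \<theta>[measurable]: "\<theta> \<in> W \<rightarrow>\<^sub>M borel" and \<theta>\<Theta>: "\<And>\<omega>. \<omega> \<in> space W \<Longrightarrow> \<theta> \<omega> \<in> param_space \<Theta>"
  shows "(\<lambda>\<omega>. gradient F owner fp_scale (\<theta> \<omega>) x) \<in> W \<rightarrow>\<^sub>M count_space UNIV"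
proof -
  have \<Theta>: "open \<Theta>" and diff: "\<And>p y \<rho>. \<rho> \<in> \<Theta> \<Longrightarrow> F p y differentiable (at \<rho>)"
    using F by (auto simp: component_densities_def)
  have \<pi>[measurable]: "(\<lambda>\<omega>. fst (\<theta> \<omega>) $ k) \<in> borel_measurable W" for k
    by (rule measurable_compose[OF \<theta>], rule borel_measurable_continuous_onI)
       (intro continuous_intros)
  have \<rho>[measurable]: "(\<lambda>\<omega>. snd (\<theta> \<omega>) $ k) \<in> borel_measurable W" for k
    by (rule measurable_compose[OF \<theta>], rule borel_measurable_continuous_onI)
       (intro continuous_intros)
  have \<rho>\<Theta>: "snd (\<theta> \<omega>) $ k \<in> \<Theta>" if "\<omega> \<in> space W" for \<omega> k
    using \<theta>\<Theta>[OF that] by (auto simp: param_space_def)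
  have [measurable]: "(\<lambda>\<omega>. F p y (snd (\<theta> \<omega>) $ k)) \<in> borel_measurable W" for p y k
    by (rule borel_measurable_compose_continuous_on[OF _ \<rho> \<rho>\<Theta>])
       (auto intro!: differentiable_imp_continuous_on
         simp: differentiable_on_def diff differentiable_at_withinI)
  have [measurable]: "(\<lambda>\<omega>. partial_deriv (F p y) j (snd (\<theta> \<omega>) $ k)) \<in> borel_measurable W" for p y j k
    by (rule borel_measurable_partial_deriv[OF \<Theta> diff \<rho> \<rho>\<Theta>])
  have [measurable]: "(\<lambda>\<omega>. gradient_entry F owner (\<theta> \<omega>) x c) \<in> borel_measurable W" for c
    unfolding gradient_entry_def mixture_density_def by (cases c) (auto split: prod.split)
  have entry: "(\<lambda>\<omega>. gradient F owner fp_scale (\<theta> \<omega>) x c) \<in> W \<rightarrow>\<^sub>M count_space UNIV" for c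
    unfolding gradient_def by (rule measurable_compose[OF _ measurable_truncate]) measurable
  show ?thesis
    unfolding measurable_count_space_eq2_countable
  proof safe
    fix v :: "'k + 'k \<times> 'j \<Rightarrow> int"
    \<comment> \<open>Integer vectors over a finite index type are countably many, so preimages of
      single vectors suffice; each is a finite intersection over the coordinates.\<close>
    have "(\<lambda>\<omega>. gradient F owner fp_scale (\<theta> \<omega>) x) -` {v} \<inter> space W =
        {\<omega> \<in> space W. \<forall>c. gradient F owner fp_scale (\<theta> \<omega>) x c = v c}"
      by (auto simp: fun_eq_iff)
    also have "\<dots> \<in> sets W"
      using entry by measurable
    finally show "(\<lambda>\<omega>. gradient F owner fp_scale (\<theta> \<omega>) x) -` {v} \<inter> space W \<in> sets W" .
  qed simp
qed

lemma measurable_clip: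
  fixes v :: "'w \<Rightarrow> 'c::finite \<Rightarrow> int"
  assumes "v \<in> W \<rightarrow>\<^sub>M count_space UNIV"
  shows "(\<lambda>\<omega>. clip C (v \<omega>)) \<in> W \<rightarrow>\<^sub>M count_space UNIV"
  by (rule measurable_compose[OF assms]) simp

section \<open>Parameters recomputed from the released vectors\<close>

text \<open>The value is the actual parameter only for \<open>t \<le> length gs\<close>. For larger
  \<open>t\<close> it is still defined and measurable, so a map on all lists can be built from
  it.\<close>

primrec replay ::
    "real \<Rightarrow> ('w \<Rightarrow> ('k::finite, 'j::finite) params) \<Rightarrow>
     (nat \<Rightarrow> 'w \<Rightarrow> ('k, 'j) params \<Rightarrow> real^('k + 'k \<times> 'j)) \<Rightarrow>
     (nat \<Rightarrow> 'w \<Rightarrow> ('k, 'j) params \<Rightarrow> real^('k + 'k \<times> 'j) \<Rightarrow> ('k, 'j) params) \<Rightarrow>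
     'w \<Rightarrow> ('k + 'k \<times> 'j \<Rightarrow> int) list \<Rightarrow> nat \<Rightarrow> ('k, 'j) params" where
  "replay fp_scale init reg update \<omega> gs 0 = init \<omega>"
| "replay fp_scale init reg update \<omega> gs (Suc t) =
     (let \<theta> = replay fp_scale init reg update \<omega> gs t
      in update t \<omega> \<theta> ((\<chi> c. real_of_int ((gs ! t) c) / fp_scale) + reg t \<omega> \<theta>))"

lemma replay_append:
  "t \<le> length gs \<Longrightarrow>
    replay fp_scale init reg update \<omega> (gs @ gs') t = replay fp_scale init reg update \<omega> gs t"
  by (induction t) (auto simp: nth_append)

text \<open>This keeps the parameters where the densities are differentiable, as the measurability
  of the gradient requires.\<close>

lemma replay_in_param_space:
  assumes "init \<omega> \<in> param_space \<Theta>"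
    and "\<And>t \<theta> v. \<theta> \<in> param_space \<Theta> \<Longrightarrow> update t \<omega> \<theta> v \<in> param_space \<Theta>"
  shows "replay fp_scale init reg update \<omega> gs t \<in> param_space \<Theta>"
  by (induction t) (auto simp: Let_def assms)

lemma measurable_replay:
  assumes init: "init \<in> W \<rightarrow>\<^sub>M borel"
    and reg: "\<And>t. (\<lambda>(\<omega>, \<theta>). reg t \<omega> \<theta>) \<in> W \<Otimes>\<^sub>M borel \<rightarrow>\<^sub>M borel"
    and update: "\<And>t. (\<lambda>(\<omega>, \<theta>, v). update t \<omega> \<theta> v) \<in> W \<Otimes>\<^sub>M borel \<Otimes>\<^sub>M borel \<rightarrow>\<^sub>M borel"
  shows "(\<lambda>\<omega>. replay fp_scale init reg update \<omega> gs t) \<in> W \<rightarrow>\<^sub>M borel"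
proof (induction t)
  case (Suc t)
  note [measurable] = Suc
  have [measurable]: "(\<lambda>\<omega>. reg t \<omega> (replay fp_scale init reg update \<omega> gs t)) \<in> W \<rightarrow>\<^sub>M borel"
    using measurable_compose[OF _ reg, of "\<lambda>\<omega>. (\<omega>, replay fp_scale init reg update \<omega> gs t)" W t]
    by simp
  show ?case
    using measurable_compose[OF _ update, of "\<lambda>\<omega>. (\<omega>, replay fp_scale init reg update \<omega> gs t,
      (\<chi> c. real_of_int ((gs ! t) c) / fp_scale) + reg t \<omega> (replay fp_scale init reg update \<omega> gs t))" W t]
    by (simp add: Let_def)
qed (simp add: init)

lemma dpvi_vpd_run_eq_map_released:
  "dpvi_vpd_run F owner fp_scale C \<sigma> q init reg update \<omega> D t =
     map_pmf (\<lambda>gs. (gs, map (replay fp_scale init reg update \<omega> gs) [0..<Suc t]))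
       (released C \<sigma> q (\<lambda>gs x.
          clip C (gradient F owner fp_scale (replay fp_scale init reg update \<omega> gs (length gs)) x)) D t)"
    (is "_ = map_pmf (\<lambda>gs. (gs, map (?\<theta> gs) _)) (released _ _ _ ?h _ _)")
proof (induction t)
  case (Suc t)
  have step: "(let \<theta> = last (map (?\<theta> gs) [0..<Suc t])
      in poisson_batch q (length D) \<bind> (\<lambda>B. discrete_gaussian_vec UNIV (C * \<sigma>) \<bind> (\<lambda>\<zeta>.
        let g = (\<lambda>c. (\<Sum>n\<in>B. clip C (gradient F owner fp_scale \<theta> (D ! n)) c) + \<zeta> c);
            v = (\<chi> c. real_of_int (g c) / fp_scale) + reg t \<omega> \<theta>
        in return_pmf (gs @ [g], map (?\<theta> gs) [0..<Suc t] @ [update t \<omega> \<theta> v])))) =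
      noisy_sum C \<sigma> q (map (?h gs) D) \<bind> (\<lambda>g.
        return_pmf (gs @ [g], map (?\<theta> (gs @ [g])) [0..<Suc (Suc t)]))"
    if "gs \<in> set_pmf (released C \<sigma> q ?h D t)" for gs
  proof -
    have len: "length gs = t"
      using that by (rule length_released)
    have sum: "(\<Sum>n\<in>B. clip C (gradient F owner fp_scale (?\<theta> gs t) (D ! n)) c) =
        (\<Sum>n\<in>B. (map (?h gs) D ! n) c)" if "B \<in> set_pmf (poisson_batch q (length D))" for B c
      using that set_pmf_poisson_batch by (intro sum.cong) (fastforce simp: len)+
    \<comment> \<open>Earlier parameters do not see \<open>g\<close>; the new one reads
      \<open>(gs @ [g]) ! t\<close>, which is \<open>g\<close> because
      \<open>length gs = t\<close>.\<close>
    have \<theta>s: "map (?\<theta> (gs @ [g])) [0..<Suc (Suc t)] = map (?\<theta> gs) [0..<Suc t] @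
        [update t \<omega> (?\<theta> gs t) ((\<chi> c. real_of_int (g c) / fp_scale) + reg t \<omega> (?\<theta> gs t))]" for g
      by (simp add: replay_append len Let_def nth_append)
    show ?thesis
      unfolding noisy_sum_def bind_assoc_pmf bind_return_pmf length_map \<theta>s
      by (auto simp: Let_def sum simp del: of_int_sum of_int_add intro!: bind_pmf_cong)
  qed
  show ?case
    unfolding dpvi_vpd_run.simps Suc bind_map_pmf released.simps map_bind_pmf map_return_pmf
      prod.case bind_return_pmf
    by (rule bind_pmf_cong[OF refl step])
qed simp

section \<open>Privacy of the analyst's view\<close>

theorem theorem5p1:
  fixes \<O> :: "real \<Rightarrow> real \<Rightarrow> nat \<Rightarrow> mechanism \<Rightarrow> ennreal"
    and \<delta> q C \<sigma> fp_scale :: real and T :: nat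
    and \<nu> :: "'p::finite \<Rightarrow> 'a measure"
    and \<Theta> :: "(real^'j) set"
    and owner :: "'j::finite \<Rightarrow> 'p"
    and F :: "'p \<Rightarrow> 'a \<Rightarrow> real^'j \<Rightarrow> real"
    and W :: "'w measure"
    and init :: "'w \<Rightarrow> ('k::finite, 'j) params"
    and reg :: "nat \<Rightarrow> 'w \<Rightarrow> ('k, 'j) params \<Rightarrow> real^('k + 'k \<times> 'j)"
    and update :: "nat \<Rightarrow> 'w \<Rightarrow> ('k, 'j) params \<Rightarrow> real^('k + 'k \<times> 'j) \<Rightarrow> ('k, 'j) params"
  assumes "accounting_oracle TYPE('p \<Rightarrow> 'a) TYPE('w) \<O>"
    and "0 \<le> \<delta>" and "0 \<le> q" "q \<le> 1" and "0 < C" and "0 < \<sigma>" and "0 < fp_scale"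
    and "component_densities \<nu> \<Theta> owner F"
    and "prob_space W"
    and "init \<in> W \<rightarrow>\<^sub>M borel"
    and "\<And>t. (\<lambda>(\<omega>, \<theta>). reg t \<omega> \<theta>) \<in> W \<Otimes>\<^sub>M borel \<rightarrow>\<^sub>M borel"
    and "\<And>t. (\<lambda>(\<omega>, \<theta>, v). update t \<omega> \<theta> v) \<in> W \<Otimes>\<^sub>M borel \<Otimes>\<^sub>M borel \<rightarrow>\<^sub>M borel"
    and "\<And>\<omega>. \<omega> \<in> space W \<Longrightarrow> init \<omega> \<in> param_space \<Theta>"
    and "\<And>t \<omega> \<theta> v. \<omega> \<in> space W \<Longrightarrow> \<theta> \<in> param_space \<Theta> \<Longrightarrow> update t \<omega> \<theta> v \<in> param_space \<Theta>"
  shows "differentially_private (\<O> \<delta> q T (discrete_gaussian_mechanism \<sigma>)) \<delta>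
           (dpvi_vpd_view F owner fp_scale C \<sigma> q T W init reg update)"
proof -
  interpret prob_space W by fact
  define \<theta> where "\<theta> = replay fp_scale init reg update"
  define h where "h = (\<lambda>\<omega> gs x. clip C (gradient F owner fp_scale (\<theta> \<omega> gs (length gs)) x))"
  define V :: "(('k + 'k \<times> 'j \<Rightarrow> int) list \<times> (nat \<Rightarrow> ('k, 'j) params)) measure"
    where "V = count_space UNIV \<Otimes>\<^sub>M (\<Pi>\<^sub>M t\<in>{..T}. borel)"
  \<comment> \<open>\<open>\<Phi> \<omega>\<close> is post-processing for fixed \<omega> only, so
    the view is treated as the mixture over \<open>W\<close> of the kernels
    \<open>K D\<close>.\<close>
  define \<Phi> where "\<Phi> = (\<lambda>\<omega> gs. (gs, \<lambda>t\<in>{..T}. \<theta> \<omega> gs t))"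
  define K where "K = (\<lambda>D \<omega>. distr (measure_pmf (released C \<sigma> q (h \<omega>) D T)) V (\<Phi> \<omega>))"
  have \<theta>_meas[measurable]: "(\<lambda>\<omega>. \<theta> \<omega> gs t) \<in> W \<rightarrow>\<^sub>M borel" for gs t
    unfolding \<theta>_def by (rule measurable_replay[OF assms(10-12)])
  have h_meas: "(\<lambda>\<omega>. h \<omega> gs x) \<in> W \<rightarrow>\<^sub>M count_space UNIV" for gs x
    unfolding h_def
    by (intro measurable_clip measurable_gradient[OF assms(8) \<theta>_meas])
       (auto simp: \<theta>_def intro!: replay_in_param_space assms(13,14))
  have \<Phi>_space: "\<Phi> \<omega> \<in> measure_pmf p \<rightarrow>\<^sub>M V" for \<omega> p
    by (auto simp: \<Phi>_def V_def space_pair_measure space_PiM)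
  have "case_prod \<Phi> \<in> W \<Otimes>\<^sub>M count_space UNIV \<rightarrow>\<^sub>M V"
    unfolding case_prod_beta
  proof (rule measurable_compose_countable[where g = snd])
    show "(\<lambda>z. \<Phi> (fst z) gs) \<in> W \<Otimes>\<^sub>M count_space UNIV \<rightarrow>\<^sub>M V" for gs
      unfolding \<Phi>_def V_def by measurable
  qed simp
  then have K: "K D \<in> W \<rightarrow>\<^sub>M subprob_algebra V" for D
    unfolding K_def by (rule measurable_distr2[OF _ measurable_released[OF h_meas]])
  have view: "dpvi_vpd_view F owner fp_scale C \<sigma> q T W init reg update D = W \<bind> K D" for D
  proof -
    have "distr (measure_pmf (dpvi_vpd_run F owner fp_scale C \<sigma> q init reg update \<omega> D T)) V
        (\<lambda>(gs, \<theta>s). (gs, \<lambda>t\<in>{..T}. \<theta>s ! t)) = K D \<omega>" for \<omega>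
    proof -
      \<comment> \<open>The list of parameters has \<open>T + 1\<close> entries, so each index up to
        \<open>T\<close> is valid; elsewhere both restricted functions are
        \<open>undefined\<close>.\<close>
      have "(\<lambda>(gs, \<theta>s). (gs, \<lambda>t\<in>{..T}. \<theta>s ! t)) \<circ> (\<lambda>gs. (gs, map (\<theta> \<omega> gs) [0..<Suc T])) = \<Phi> \<omega>"
        by (auto simp: \<Phi>_def fun_eq_iff restrict_def simp del: upt_Suc)
      then show ?thesis
        unfolding dpvi_vpd_run_eq_map_released K_def h_def \<theta>_def[symmetric] map_pmf_rep_eq
        by (subst distr_distr) (auto simp: V_def space_pair_measure space_PiM split: if_splits)
    qed
    then show ?thesis
      unfolding dpvi_vpd_view_def V_def[symmetric] by simp
  qed
  let ?\<epsilon> = "\<O> \<delta> q T (discrete_gaussian_mechanism \<sigma>)"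
  show ?thesis
    unfolding differentially_private_def view
  proof (intro disj_imp[THEN iffD2] allI impI ballI)
    fix D D' S
    assume \<epsilon>: "?\<epsilon> \<noteq> \<top>" and adj: "adjacent D D'" and S: "S \<in> sets (W \<bind> K D)"
    have SV: "S \<in> sets V"
      using S sets_bind[of W "K D" V] sets_kernel[OF K] not_empty by auto
    have meas[measurable]: "(\<lambda>\<omega>. measure (K D \<omega>) S) \<in> borel_measurable W" for D
      using measurable_compose[OF K measurable_measure_subprob_algebra[OF SV]] .
    have int: "integrable W (\<lambda>\<omega>. measure (K D \<omega>) S)" for D
      by (rule integrable_const_bound[where B = 1])
         (auto intro!: AE_I2 subprob_space.subprob_measure_le_1 subprob_space_kernel[OF K])
    \<comment> \<open>Clipping bounds the norm whatever the parameters are, so this holds for every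
      \<omega>; the oracle value does not depend on \<omega>, hence one \<epsilon> serves
      all.\<close>
    have pointwise: "measure (K D \<omega>) S \<le> exp (enn2real ?\<epsilon>) * measure (K D' \<omega>) S + \<delta>" for \<omega>
    proof -
      have "differentially_private ?\<epsilon> \<delta> (\<lambda>D. measure_pmf (released C \<sigma> q (h \<omega>) D T))"
        by (rule released_private[OF assms(1-5)]) (simp add: h_def l2_norm_clip_le assms(5))
      then show ?thesis
        using \<epsilon> adj unfolding differentially_private_def K_def
        by (simp add: measure_distr[OF \<Phi>_space SV])
    qed
    have "measure (W \<bind> K D) S = (\<integral>\<omega>. measure (K D \<omega>) S \<partial>W)"
      by (rule measure_bind[OF K SV])
    \<comment> \<open>The bound is linear in the probabilities, so it survives averaging; \<delta>
      stays \<delta> because \<open>W\<close> has mass 1.\<close>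
    also have "\<dots> \<le> (\<integral>\<omega>. exp (enn2real ?\<epsilon>) * measure (K D' \<omega>) S + \<delta> \<partial>W)"
      using pointwise int by (intro integral_mono) auto
    also have "\<dots> = exp (enn2real ?\<epsilon>) * measure (W \<bind> K D') S + \<delta>"
      using int by (simp add: measure_bind[OF K SV] prob_space)
    finally show "measure (W \<bind> K D) S \<le> exp (enn2real ?\<epsilon>) * measure (W \<bind> K D') S + \<delta>" .
  qed
qed

end
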